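(* Let $\mathcal{G}$ be a weighted undirected graph on $V=\{1,\dots,N\}$, let $F\subseteq\{1,\dots,N\}$ be a set of frequency indices and $S\subseteq V$ a sampling set of vertices, let $\mathbf{D}$ and $\mathbf{B}$ be the associated vertex-limiting and frequency-limiting operators, and let $\mathbf{D}^c$ be the vertex-limiting operator associated with $S^c=V\setminus S$. Let $\{\psi_i\}_{i=1}^N$ be an orthonormal basis of $\mathbb{R}^N$ consisting of eigenvectors of $\mathbf{B}\mathbf{D}\mathbf{B}$, with corresponding eigenvalues $\sigma_1^2\ge\sigma_2^2\ge\dots\ge\sigma_N^2$. If $$\|\mathbf{B}\mathbf{D}^c\|_2<1,$$ then every signal $f\in\mathbb{R}^N$ bandlimited to $F$ (i.e. $\mathbf{B}f=f$) can be reconstructed from its samples on $S$, i.e. from $\mathbf{D}f$, by the formula $$f=\sum_{i=1}^{|F|}\frac{1}{\sigma_i^2}\,\langle \mathbf{D}f,\psi_i\rangle\,\psi_i .$$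
   Context: $\mathcal{G}$ is a weighted undirected graph with vertex set $V=\{1,\dots,N\}$ and symmetric adjacency matrix $\mathbf{A}=(a_{ij})$, with $a_{ij}>0$ if there is a link between $i$ and $j$ and $a_{ij}=0$ otherwise. The degree matrix is $\mathbf{K}=\mathrm{diag}(d_1,\dots,d_N)$ with $d_i=\sum_{j}a_{ij}$, and the Laplacian is $\mathbf{L}=\mathbf{K}-\mathbf{A}$, a real symmetric positive semidefinite matrix. Fix an eigendecomposition $\mathbf{L}=\mathbf{U}\mathbf{\Lambda}\mathbf{U}^T$ with $\mathbf{U}$ a real orthogonal matrix whose columns are the eigenvectors. A signal on the graph is a vector in $\mathbb{R}^N$; its Graph Fourier Transform is $\hat f=\mathbf{U}^Tf$. For $S\subseteq V$, the vertex-limiting operator $\mathbf{D}$ is the diagonal $N\times N$ matrix with $D_{ii}=1$ if $i\in S$ and $D_{ii}=0$ otherwise; $\mathbf{D}^c$ is defined in the same way with $S$ replaced by $S^c=V\setminus S$. For $F\subseteq\{1,\dots,N\}$, the frequency-limiting operator is $\mathbf{B}=\mathbf{U}\mathbf{\Sigma}\mathbf{U}^T$, where $\mathbf{\Sigma}$ is the diagonal matrix with $\Sigma_{ii}=1$ if $i\in F$ and $\Sigma_{ii}=0$ otherwise. A signal $f$ is bandlimited to $F$ if its Graph Fourier Transform is supported on $F$, equivalently $\mathbf{B}f=f$. $\|\cdot\|_2$ of a matrix is the spectral norm (largest singular value), and $\langle\cdot,\cdot\rangle$ is the standard inner product on $\mathbb{R}^N$. The matrix $\mathbf{B}\mathbf{D}\mathbf{B}$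 is symmetric positive semidefinite. Part of the assertion is that $\sigma_i^2\neq0$ for $i=1,\dots,|F|$, so that the formula makes sense. *)

theory Defs
  imports "HOL-Analysis.Analysis"
begin

text \<open>The index type \<open>'n\<close> plays the role of \<open>{1..N}\<close> with \<open>N = CARD('n)\<close>, both for the vertices
  and for the graph frequencies (the columns of the eigenvector matrix).\<close>

definition diag :: "real^'n \<Rightarrow> real^'n^'n" where
  "diag d = (\<chi> i j. if i = j then d $ i else 0)"

text \<open>A graph is given by its weights: \<open>i\<close> and \<open>j\<close> are linked iff \<open>A $ i $ j > 0\<close>.\<close>

definition weighted_graph :: "real^'n^'n \<Rightarrow> bool" where
  "weighted_graph A \<longleftrightarrow> transpose A = A \<and> (\<forall>i j. A $ i $ j \<ge> 0)"

definition degree_matrix :: "real^'n^'n \<Rightarrow> real^'n^'n" where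
  "degree_matrix A = diag (\<chi> i. \<Sum>j\<in>UNIV. A $ i $ j)"

definition laplacian :: "real^'n^'n \<Rightarrow> real^'n^'n" where
  "laplacian A = degree_matrix A - A"

definition laplacian_eigendecomposition ::
  "real^'n^'n \<Rightarrow> real^'n^'n \<Rightarrow> real^'n \<Rightarrow> bool" where
  "laplacian_eigendecomposition A U lam \<longleftrightarrow>
     orthogonal_matrix U \<and> laplacian A = U ** diag lam ** transpose U"

definition gft :: "real^'n^'n \<Rightarrow> real^'n \<Rightarrow> real^'n" where
  "gft U f = transpose U *v f"

definition vertex_limiting :: "'n set \<Rightarrow> real^'n^'n" where
  "vertex_limiting S = diag (\<chi> i. if i \<in> S then 1 else 0)"

definition freq_limiting :: "real^'n^'n \<Rightarrow> 'n set \<Rightarrow> real^'n^'n" where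
  "freq_limiting U F = U ** diag (\<chi> i. if i \<in> F then 1 else 0) ** transpose U"

definition bandlimited :: "real^'n^'n \<Rightarrow> 'n set \<Rightarrow> real^'n \<Rightarrow> bool" where
  "bandlimited U F f \<longleftrightarrow> (\<forall>k. gft U f $ k \<noteq> 0 \<longrightarrow> k \<in> F)"

lemma bandlimited_iff:
  fixes U :: "real^'n^'n"
  assumes "orthogonal_matrix U"
  shows "bandlimited U F f \<longleftrightarrow> freq_limiting U F *v f = f"
proof -
  define E :: "real^'n^'n" where "E = diag (\<chi> i. if i \<in> F then 1 else 0)"
  have E: "(E *v g) $ k = (if k \<in> F then g $ k else 0)" for g k
  proof -
    have "(E *v g) $ k = (\<Sum>j\<in>UNIV. E $ k $ j * g $ j)"
      by (simp add: matrix_vector_mult_def)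
    also have "\<dots> = (\<Sum>j\<in>UNIV. if k = j then (if k \<in> F then g $ k else 0) else 0)"
      by (rule sum.cong) (auto simp: E_def diag_def)
    finally show ?thesis by simp
  qed
  have UU: "transpose U ** U = mat 1" "U ** transpose U = mat 1"
    using assms by (auto simp: orthogonal_matrix_def)
  have B: "freq_limiting U F *v f = U *v (E *v gft U f)"
    by (simp only: freq_limiting_def E_def gft_def matrix_vector_mul_assoc matrix_mul_assoc)
  have 1: "transpose U *v (U *v g) = g" "U *v (transpose U *v g) = g" for g
    by (simp_all only: matrix_vector_mul_assoc UU matrix_vector_mul_lid)
  have "U *v (E *v gft U f) = f \<longleftrightarrow> E *v gft U f = gft U f"
    unfolding gft_def using 1 by metis
  also have "\<dots> \<longleftrightarrow> bandlimited U F f"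
    by (auto simp: bandlimited_def vec_eq_iff E)
  finally show ?thesis by (simp add: B)
qed

definition eigenpair :: "real^'n^'n \<Rightarrow> real \<Rightarrow> real^'n \<Rightarrow> bool" where
  "eigenpair M l v \<longleftrightarrow> v \<noteq> 0 \<and> M *v v = l *\<^sub>R v"

definition singular_values :: "real^'n^'n \<Rightarrow> real set" where
  "singular_values M = {sqrt l |l. \<exists>v. eigenpair (transpose M ** M) l v}"

definition spectral_norm :: "real^'n^'n \<Rightarrow> real" where
  "spectral_norm M = Max (singular_values M)"

lemma finite_singular_values:
  fixes M :: "real^'n^'n"
  shows "finite (singular_values M)"
proof -
  define G where "G = transpose M ** M"
  define L where "L = {l. \<exists>v. eigenpair G l v}"
  define w where "w = (\<lambda>l. SOME v. eigenpair G l v)"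
  have w: "w l \<noteq> 0" "G *v w l = l *\<^sub>R w l" if "l \<in> L" for l
    using that someI_ex[of "eigenpair G l"] by (auto simp: L_def w_def eigenpair_def)
  have sym: "(G *v x) \<bullet> y = x \<bullet> (G *v y)" for x y
    unfolding G_def by (metis dot_lmul_matrix matrix_transpose_mul transpose_matrix_vector transpose_transpose)
  have orth: "orthogonal (w l) (w m)" if "l \<in> L" "m \<in> L" "l \<noteq> m" for l m
    using sym[of "w l" "w m"] w that by (auto simp: orthogonal_def)
  have inj: "inj_on w L"
    using orth w(1) by (metis inj_onI orthogonal_self)
  have "pairwise orthogonal (w ` L)"
    using orth by (auto simp: pairwise_def)
  moreover have "0 \<notin> w ` L" using w(1) by force
  ultimately have "finite (w ` L)"
    using pairwise_orthogonal_independent independent_imp_finite by blast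
  then have "finite L" using inj finite_imageD by blast
  moreover have "singular_values M = sqrt ` L"
    by (auto simp: singular_values_def L_def G_def)
  ultimately show ?thesis by simp
qed

lemma spectral_norm_eq_onorm:
  fixes M :: "real^'n^'n"
  shows "spectral_norm M = onorm ((*v) M)"
proof -
  define c where "c = onorm ((*v) M)"
  have bl: "bounded_linear ((*v) M)" by (rule matrix_vector_mul_bounded_linear)
  have c0: "c \<ge> 0" unfolding c_def by (rule onorm_pos_le[OF bl])
  have le: "norm (M *v x) \<le> c * norm x" for x
    unfolding c_def by (rule onorm[OF bl])
  have adj: "(transpose M *v y) \<bullet> x = y \<bullet> (M *v x)" for x y
    by (metis dot_lmul_matrix transpose_matrix_vector)
  have quad: "((transpose M ** M) *v x) \<bullet> y = (M *v x) \<bullet> (M *v y)" for x y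
    by (metis adj matrix_vector_mul_assoc)
  have leT: "norm (transpose M *v y) \<le> c * norm y" for y
  proof -
    have "norm (transpose M *v y) * norm (transpose M *v y) = y \<bullet> (M *v (transpose M *v y))"
      by (metis adj norm_eq_sqrt_inner power2_eq_square power2_norm_eq_inner)
    also have "\<dots> \<le> norm y * (c * norm (transpose M *v y))"
      by (meson le mult_left_mono norm_cauchy_schwarz norm_ge_zero order_trans)
    finally have *: "norm (transpose M *v y) * norm (transpose M *v y)
        \<le> (c * norm y) * norm (transpose M *v y)" by (simp add: algebra_simps)
    show ?thesis
    proof (cases "norm (transpose M *v y) = 0")
      case True
      then show ?thesis using c0 by simp
    next
      case False
      then show ?thesis using * mult_right_le_imp_le by fastforce
    qed
  qed
  obtain u :: "real^'n" where u1: "norm u = 1"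
    using vector_choose_size[of 1] by auto
  have "continuous_on (sphere 0 1) (\<lambda>x. norm (M *v x))"
    by (intro continuous_intros linear_continuous_on bl)
  then obtain x where x: "norm x = 1" and
    mx: "\<And>y. norm y = 1 \<Longrightarrow> norm (M *v y) \<le> norm (M *v x)"
    using continuous_attains_sup[of "sphere 0 1" "\<lambda>x. norm (M *v x)"] u1 by force
  have "norm (M *v y) \<le> norm (M *v x) * norm y" for y
  proof (cases "y = 0")
    case False
    have "norm (M *v ((1 / norm y) *\<^sub>R y)) \<le> norm (M *v x)"
      using False by (intro mx) simp
    then show ?thesis using False
      by (simp add: matrix_vector_mult_scaleR divide_simps)
  qed simp
  then have "c \<le> norm (M *v x)" unfolding c_def by (rule onorm_le)
  then have cx: "norm (M *v x) = c" using le[of x] x by simp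
  define z where "z = (transpose M ** M) *v x"
  have "norm z \<le> c * c"
    using leT[of "M *v x"] cx by (simp add: z_def matrix_vector_mul_assoc)
  then have z: "z \<bullet> z \<le> (c\<^sup>2)\<^sup>2"
    by (metis norm_ge_zero power2_eq_square power2_norm_eq_inner power_mono)
  have zx: "z \<bullet> x = c\<^sup>2" using quad[of x x] cx by (simp add: z_def power2_norm_eq_inner[symmetric])
  have xx: "x \<bullet> x = 1" using x by (simp add: power2_norm_eq_inner[symmetric])
  have "(z - c\<^sup>2 *\<^sub>R x) \<bullet> (z - c\<^sup>2 *\<^sub>R x) = z \<bullet> z - 2 * c\<^sup>2 * (z \<bullet> x) + (c\<^sup>2)\<^sup>2 * (x \<bullet> x)"
    by (simp add: inner_diff_left inner_diff_right inner_commute algebra_simps power2_eq_square)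
  also have "\<dots> \<le> 0" using z by (simp add: zx xx power2_eq_square algebra_simps)
  finally have "z = c\<^sup>2 *\<^sub>R x"
    using inner_ge_zero[of "z - c\<^sup>2 *\<^sub>R x"] inner_eq_zero_iff[of "z - c\<^sup>2 *\<^sub>R x"] by simp
  then have "eigenpair (transpose M ** M) (c\<^sup>2) x"
    using x by (auto simp: eigenpair_def z_def)
  then have mem: "c \<in> singular_values M"
    using c0 by (auto simp: singular_values_def intro!: exI[of _ "c\<^sup>2"])
  have ub: "s \<le> c" if "s \<in> singular_values M" for s
  proof -
    obtain l v where s: "s = sqrt l" and v: "v \<noteq> 0" "(transpose M ** M) *v v = l *\<^sub>R v"
      using \<open>s \<in> singular_values M\<close> by (auto simp: singular_values_def eigenpair_def)
    have "l * (norm v)\<^sup>2 = (norm (M *v v))\<^sup>2"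
      using quad[of v v] v by (simp add: power2_norm_eq_inner)
    also have "\<dots> \<le> (c * norm v)\<^sup>2" by (rule power_mono[OF le]) simp
    finally have "l \<le> c\<^sup>2" using v(1) by (simp add: power_mult_distrib)
    then show ?thesis using s c0 by (simp add: real_le_lsqrt)
  qed
  show ?thesis unfolding spectral_norm_def c_def[symmetric]
    by (rule Max_eqI[OF finite_singular_values ub mem])
qed

text \<open>Families indexed by \<open>1, \<dots>, N\<close>; values at other indices are irrelevant.\<close>

definition orthonormal_basis :: "(nat \<Rightarrow> real^'n) \<Rightarrow> bool" where
  "orthonormal_basis \<psi> \<longleftrightarrow>
     (\<forall>i\<in>{1..CARD('n)}. \<forall>j\<in>{1..CARD('n)}. \<psi> i \<bullet> \<psi> j = (if i = j then 1 else 0)) \<and>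
     span (\<psi> ` {1..CARD('n)}) = UNIV"

end

theory Submission
  imports Defs
begin

text \<open>The operators \<open>B\<close> and \<open>D\<close> are orthogonal projections. If \<open>B x = x\<close> and \<open>D x = 0\<close>, then
  \<open>B D\<^sup>c x = x\<close>, which forces \<open>x = 0\<close> because \<open>B D\<^sup>c\<close> is a strict contraction; hence \<open>B D B\<close> and \<open>B\<close>
  have the same kernel. So \<open>B\<close> fixes the \<open>\<psi>\<^sub>i\<close> with \<open>\<sigma>\<^sub>i\<^sup>2 \<noteq> 0\<close> and kills the others, and computing
  the trace of \<open>B\<close> in the basis \<open>\<psi>\<close> shows that there are exactly \<open>|F|\<close> of the former. Since
  \<open>\<langle>D f, \<psi>\<^sub>i\<rangle> = \<langle>f, B D B \<psi>\<^sub>i\<rangle> = \<sigma>\<^sub>i\<^sup>2 \<langle>f, \<psi>\<^sub>i\<rangle>\<close> for those \<open>i\<close>, the formula is the expansion of \<open>f\<close>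
  in the basis \<open>\<psi>\<close>.\<close>

lemma diag_mult_vec_nth [simp]: "(diag d *v x) $ k = d $ k * x $ k"
  by (simp add: diag_def matrix_vector_mult_def if_distrib[of "\<lambda>c. c * _"] cong: if_cong)

lemma vertex_limiting_mult_vec_nth [simp]:
  "(vertex_limiting S *v x) $ k = (if k \<in> S then x $ k else 0)"
  by (simp add: vertex_limiting_def)

lemma vertex_limiting_self_adjoint:
  "(vertex_limiting S *v x) \<bullet> y = x \<bullet> (vertex_limiting S *v y)"
  by (auto simp: inner_vec_def intro!: sum.cong)

lemma vertex_limiting_idem [simp]:
  "vertex_limiting S *v (vertex_limiting S *v x) = vertex_limiting S *v x"
  by (simp add: vec_eq_iff)

lemma vertex_limiting_compl: "vertex_limiting (- S) *v x = x - vertex_limiting S *v x"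
  by (simp add: vec_eq_iff)

lemma gft_nth: "gft U x $ k = column k U \<bullet> x"
  by (simp add: gft_def matrix_vector_mult_def transpose_def column_def inner_vec_def)

text \<open>Writing \<open>B\<close> as a sum of rank-one projections makes its symmetry evident and
  reduces its trace to inner products with the columns of \<open>U\<close>.\<close>

lemma freq_limiting_mult_vec:
  "freq_limiting U F *v x = (\<Sum>k\<in>F. (column k U \<bullet> x) *\<^sub>R column k U)"
proof -
  define g where "g = diag (\<chi> i. if i \<in> F then 1 else 0) *v gft U x"
  have "freq_limiting U F *v x = U *v g"
    by (simp only: g_def freq_limiting_def gft_def matrix_vector_mul_assoc matrix_mul_assoc)
  also have "\<dots> = (\<Sum>k\<in>UNIV. g $ k *\<^sub>R column k U)"
    by (simp add: matrix_mult_sum scalar_mult_eq_scaleR)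
  also have "\<dots> = (\<Sum>k\<in>F. (column k U \<bullet> x) *\<^sub>R column k U)"
    by (rule sum.mono_neutral_cong_right) (auto simp: g_def gft_nth)
  finally show ?thesis .
qed

lemma freq_limiting_self_adjoint:
  "(freq_limiting U F *v x) \<bullet> y = x \<bullet> (freq_limiting U F *v y)"
  by (simp add: freq_limiting_mult_vec inner_sum_left inner_sum_right inner_commute mult.commute)

text \<open>The columns of \<open>U\<close> are orthogonal, so the image of any vector has no
  component along columns outside \<open>F\<close>; it is bandlimited, and
  \<open>bandlimited_iff\<close> applies.\<close>

lemma freq_limiting_idem:
  fixes U :: "real^'n^'n"
  assumes "orthogonal_matrix U"
  shows "freq_limiting U F *v (freq_limiting U F *v x) = freq_limiting U F *v x"
proof -
  have "column k U \<bullet> column l U = 0" if "k \<noteq> l" for k l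
    using assms that by (simp add: orthogonal_matrix_orthonormal_columns orthogonal_def)
  then have "bandlimited U F (freq_limiting U F *v x)"
    unfolding bandlimited_def gft_nth freq_limiting_mult_vec inner_sum_right
    by (metis (no_types, lifting) inner_scaleR_right mult_zero_right sum.neutral)
  then show ?thesis
    by (simp add: bandlimited_iff[OF assms])
qed

text \<open>The difference of the two sides is orthogonal to every basis vector, hence to their
  span, which is the whole space, hence to itself.\<close>

lemma orthonormal_basis_expansion:
  fixes \<psi> :: "nat \<Rightarrow> real^'n"
  assumes "orthonormal_basis \<psi>"
  shows "x = (\<Sum>i=1..CARD('n). (x \<bullet> \<psi> i) *\<^sub>R \<psi> i)" (is "x = ?s")
proof -
  have "(x - ?s) \<bullet> \<psi> j = 0" if "j \<in> {1..CARD('n)}" for j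
  proof -
    have "?s \<bullet> \<psi> j = (\<Sum>i=1..CARD('n). if i = j then x \<bullet> \<psi> j else 0)"
      unfolding inner_sum_left
      using assms that by (intro sum.cong) (auto simp: orthonormal_basis_def)
    then show ?thesis
      using that by (simp add: inner_diff_left)
  qed
  then have *: "orthogonal (x - ?s) z" if "z \<in> \<psi> ` {1..CARD('n)}" for z
    using that by (auto simp: orthogonal_def)
  have "orthogonal (x - ?s) y" if "y \<in> span (\<psi> ` {1..CARD('n)})" for y
    using that * by (rule orthogonal_to_span)
  then have "orthogonal (x - ?s) (x - ?s)"
    using assms by (simp add: orthonormal_basis_def)
  then show ?thesis
    by (simp add: orthogonal_self)
qed

lemma orthonormal_basis_parseval:
  fixes \<psi> :: "nat \<Rightarrow> real^'n"
  assumes "orthonormal_basis \<psi>"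
  shows "(\<Sum>i=1..CARD('n). (x \<bullet> \<psi> i)\<^sup>2) = (norm x)\<^sup>2"
proof -
  have "(norm x)\<^sup>2 = x \<bullet> (\<Sum>i=1..CARD('n). (x \<bullet> \<psi> i) *\<^sub>R \<psi> i)"
    using orthonormal_basis_expansion[OF assms, of x] by (simp add: power2_norm_eq_inner)
  then show ?thesis
    by (simp only: inner_sum_right inner_scaleR_right power2_eq_square)
qed

text \<open>After the double sum is swapped, Parseval turns the inner sum into the squared norm of a
  column of \<open>U\<close>, so each \<open>k\<close> in \<open>F\<close> contributes 1.\<close>

lemma freq_limiting_trace:
  fixes U :: "real^'n^'n" and \<psi> :: "nat \<Rightarrow> real^'n"
  assumes "orthogonal_matrix U" and "orthonormal_basis \<psi>"
  shows "(\<Sum>i=1..CARD('n). (freq_limiting U F *v \<psi> i) \<bullet> \<psi> i) = card F"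
proof -
  have "(\<Sum>i=1..CARD('n). (freq_limiting U F *v \<psi> i) \<bullet> \<psi> i)
      = (\<Sum>i=1..CARD('n). \<Sum>k\<in>F. (column k U \<bullet> \<psi> i)\<^sup>2)"
    by (simp add: freq_limiting_mult_vec inner_sum_left power2_eq_square)
  also have "\<dots> = (\<Sum>k\<in>F. \<Sum>i=1..CARD('n). (column k U \<bullet> \<psi> i)\<^sup>2)"
    by (rule sum.swap)
  also have "\<dots> = card F"
    using assms
    by (simp add: orthonormal_basis_parseval orthogonal_matrix_orthonormal_columns
        del: One_nat_def)
  finally show ?thesis .
qed

text \<open>The spectral norm is the operator norm, so a matrix for which it is below 1 has no
  nonzero fixed vector.\<close>

lemma bandlimited_zero_samples:
  assumes "spectral_norm (B ** vertex_limiting (- S)) < 1"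
    and "B *v x = x" and "vertex_limiting S *v x = 0"
  shows "x = 0"
proof (rule ccontr)
  assume "x \<noteq> 0"
  have "(B ** vertex_limiting (- S)) *v x = x"
    using assms(2,3) by (simp add: vertex_limiting_compl flip: matrix_vector_mul_assoc)
  then have "norm x \<le> spectral_norm (B ** vertex_limiting (- S)) * norm x"
    by (metis spectral_norm_eq_onorm onorm matrix_vector_mul_bounded_linear)
  also have "\<dots> < 1 * norm x"
    using assms(1) \<open>x \<noteq> 0\<close> by (intro mult_strict_right_mono) auto
  finally show False by simp
qed

text \<open>Turns a count of the nonzero eigenvalues into their positions in the decreasing list. A
  nonempty \<open>P\<close> is \<open>{1..Max P}\<close>, so \<open>Max P\<close> is its
  cardinality.\<close>

lemma down_closed_eq_atLeastAtMost_card: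
  fixes P :: "nat set"
  assumes "P \<subseteq> {1..n}" and "\<And>i j. 1 \<le> i \<Longrightarrow> i \<le> j \<Longrightarrow> j \<in> P \<Longrightarrow> i \<in> P"
  shows "P = {1..card P}"
proof (cases "P = {}")
  case False
  have "finite P"
    using assms(1) finite_subset by blast
  have "P = {1..Max P}"
  proof (intro equalityI subsetI)
    show "i \<in> {1..Max P}" if "i \<in> P" for i
      using that assms(1) Max_ge[OF \<open>finite P\<close>] by auto
    show "i \<in> P" if "i \<in> {1..Max P}" for i
      using that assms(2) Max_in[OF \<open>finite P\<close> False] by auto
  qed
  moreover from this have "card P = Max P"
    by (metis card_atLeastAtMost diff_Suc_1 One_nat_def)
  ultimately show ?thesis
    by simp
qed simp

theorem theorem3p2:
  fixes A U :: "real^'n^'n" and lam :: "real^'n" and F S :: "'n set"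
    and D Dc B :: "real^'n^'n" and \<psi> :: "nat \<Rightarrow> real^'n" and \<sigma> :: "nat \<Rightarrow> real"
  assumes "weighted_graph A"
    and "laplacian_eigendecomposition A U lam"
    and "D = vertex_limiting S"
    and "Dc = vertex_limiting (- S)"
    and "B = freq_limiting U F"
    and "orthonormal_basis \<psi>"
    and "\<forall>i\<in>{1..CARD('n)}. eigenpair (B ** D ** B) ((\<sigma> i)\<^sup>2) (\<psi> i)"
    and "\<forall>i j. 1 \<le> i \<and> i \<le> j \<and> j \<le> CARD('n) \<longrightarrow> (\<sigma> i)\<^sup>2 \<ge> (\<sigma> j)\<^sup>2"
    and "spectral_norm (B ** Dc) < 1"
  shows "(\<forall>i\<in>{1..card F}. (\<sigma> i)\<^sup>2 \<noteq> 0) \<and>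
         (\<forall>f. bandlimited U F f \<longrightarrow>
            f = (\<Sum>i=1..card F. (1 / (\<sigma> i)\<^sup>2) *\<^sub>R (((D *v f) \<bullet> \<psi> i) *\<^sub>R \<psi> i)))"
proof -
  have U: "orthogonal_matrix U"
    using assms(2) by (simp add: laplacian_eigendecomposition_def)
  have Bsym: "(B *v x) \<bullet> y = x \<bullet> (B *v y)" for x y
    by (simp add: assms(5) freq_limiting_self_adjoint)
  have Bidem: "B *v (B *v x) = B *v x" for x
    by (simp add: assms(5) freq_limiting_idem U)
  have Dsym: "(D *v x) \<bullet> y = x \<bullet> (D *v y)" for x y
    by (simp add: assms(3) vertex_limiting_self_adjoint)
  have eig: "B *v (D *v (B *v \<psi> i)) = (\<sigma> i)\<^sup>2 *\<^sub>R \<psi> i" if "i \<in> {1..CARD('n)}" for i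
    using assms(7) that
    by (simp add: eigenpair_def matrix_vector_mul_assoc matrix_mul_assoc)
  have unit: "\<psi> i \<bullet> \<psi> i = 1" if "i \<in> {1..CARD('n)}" for i
    using assms(6) that by (simp add: orthonormal_basis_def)
  define P where "P = {i \<in> {1..CARD('n)}. (\<sigma> i)\<^sup>2 \<noteq> 0}"
  have fixed: "B *v \<psi> i = \<psi> i" if "i \<in> P" for i
  proof -
    have i: "i \<in> {1..CARD('n)}" and nz: "(\<sigma> i)\<^sup>2 \<noteq> 0"
      using that by (auto simp: P_def)
    \<comment> \<open>The eigenvalue equation puts the right-hand side in the range of
      \<open>B\<close>, which \<open>B\<close> fixes.\<close>
    have "(\<sigma> i)\<^sup>2 *\<^sub>R (B *v \<psi> i) = (\<sigma> i)\<^sup>2 *\<^sub>R \<psi> i"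
      using Bidem[of "D *v (B *v \<psi> i)"] by (simp add: eig[OF i] matrix_vector_mult_scaleR)
    then show ?thesis
      using nz by simp
  qed
  have killed: "B *v \<psi> i = 0" if "i \<in> {1..CARD('n)} - P" for i
  proof -
    have i: "i \<in> {1..CARD('n)}" and z: "(\<sigma> i)\<^sup>2 = 0"
      using that by (auto simp: P_def)
    \<comment> \<open>As \<open>D\<close> is a symmetric projection, the squared norm of
      \<open>D B \<psi>\<close> is the quadratic form of \<open>B D B\<close> at
      \<open>\<psi>\<close>, which is the eigenvalue 0.\<close>
    have "(D *v (B *v \<psi> i)) \<bullet> (D *v (B *v \<psi> i)) = (D *v (B *v \<psi> i)) \<bullet> (B *v \<psi> i)"
      by (metis Dsym assms(3) vertex_limiting_idem)
    also have "\<dots> = (B *v (D *v (B *v \<psi> i))) \<bullet> \<psi> i"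
      by (simp add: Bsym)
    also have "\<dots> = 0"
      unfolding eig[OF i] z by simp
    finally have "D *v (B *v \<psi> i) = 0"
      by simp
    then show ?thesis
      using bandlimited_zero_samples[of B S "B *v \<psi> i"] assms(3,4,9) Bidem by simp
  qed
  \<comment> \<open>In the basis \<open>\<psi>\<close> the diagonal entries of \<open>B\<close> are
    1 on \<open>P\<close> and 0 elsewhere, so the trace counts \<open>P\<close>.\<close>
  have "(\<Sum>i=1..CARD('n). (B *v \<psi> i) \<bullet> \<psi> i) = (\<Sum>i\<in>P. 1)"
    using fixed killed unit by (intro sum.mono_neutral_cong_right) (auto simp: P_def)
  then have "card P = card F"
    using freq_limiting_trace[OF U assms(6), of F] by (simp add: assms(5))
  moreover have "P = {1..card P}"
  proof (rule down_closed_eq_atLeastAtMost_card[of _ "CARD('n)"])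
    show "i \<in> P" if "1 \<le> i" "i \<le> j" "j \<in> P" for i j
    proof -
      have "0 < (\<sigma> j)\<^sup>2" "j \<le> CARD('n)"
        using \<open>j \<in> P\<close> by (auto simp: P_def)
      moreover have "(\<sigma> j)\<^sup>2 \<le> (\<sigma> i)\<^sup>2"
        using assms(8) that \<open>j \<le> CARD('n)\<close> by blast
      ultimately show ?thesis
        using that by (auto simp: P_def)
    qed
  qed (auto simp: P_def)
  ultimately have P: "P = {1..card F}"
    by simp
  have "f = (\<Sum>i=1..card F. (1 / (\<sigma> i)\<^sup>2) *\<^sub>R (((D *v f) \<bullet> \<psi> i) *\<^sub>R \<psi> i))"
    if "bandlimited U F f" for f
  proof -
    have Bf: "B *v f = f"
      using that bandlimited_iff[OF U] assms(5) by simp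
    have coeff: "(D *v f) \<bullet> \<psi> i = (\<sigma> i)\<^sup>2 * (f \<bullet> \<psi> i)" if "i \<in> P" for i
    proof -
      \<comment> \<open>Replace \<open>\<psi> i\<close> by \<open>B *v \<psi> i\<close> and move
        \<open>D\<close> across; then replace \<open>f\<close> by \<open>B *v f\<close> and move
        \<open>B\<close> across.\<close>
      have "(D *v f) \<bullet> \<psi> i = f \<bullet> (B *v (D *v (B *v \<psi> i)))"
        by (metis Bf Bsym Dsym fixed[OF that])
      then show ?thesis
        using that eig by (simp add: P_def)
    qed
    have "f = (\<Sum>i=1..CARD('n). (f \<bullet> \<psi> i) *\<^sub>R \<psi> i)"
      by (rule orthonormal_basis_expansion[OF assms(6)])
    also have "\<dots> = (\<Sum>i\<in>P. (1 / (\<sigma> i)\<^sup>2) *\<^sub>R (((D *v f) \<bullet> \<psi> i) *\<^sub>R \<psi> i))"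
    proof (rule sum.mono_neutral_cong_right)
      \<comment> \<open>With \<open>f = B f\<close>, symmetry moves \<open>B\<close> onto
        \<open>\<psi> i\<close>, which it kills.\<close>
      have "f \<bullet> \<psi> i = 0" if "i \<in> {1..CARD('n)} - P" for i
        by (metis Bf Bsym killed[OF that] inner_zero_right)
      then show "\<forall>i\<in>{1..CARD('n)} - P. (f \<bullet> \<psi> i) *\<^sub>R \<psi> i = 0"
        by simp
      show "(f \<bullet> \<psi> i) *\<^sub>R \<psi> i = (1 / (\<sigma> i)\<^sup>2) *\<^sub>R (((D *v f) \<bullet> \<psi> i) *\<^sub>R \<psi> i)" if "i \<in> P" for i
        using that coeff by (simp add: P_def)
    qed (auto simp: P_def)
    finally show ?thesis
      by (simp add: P)
  qed
  moreover have "\<forall>i\<in>{1..card F}. (\<sigma> i)\<^sup>2 \<noteq> 0"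
    unfolding P[symmetric] by (simp add: P_def)
  ultimately show ?thesis
    by blast
qed

end
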